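(* Let $\pi\colon(\Gamma,\alpha)\to(\Gamma_B,\alpha_B)$ be a GKM fiber bundle, with $\Gamma=(V,E)$ and $\Gamma_B=(V_B,E_B)$, and let $c_1,\ldots,c_m\in K_\alpha(\Gamma)$ be $K$-classes on $\Gamma$ such that for every $p\in V_B$ the restrictions of $c_1,\ldots,c_m$ to the fiber $\Gamma_p=\pi^{-1}(p)$ form a basis, over $R(T)$, of the $K$-ring $K_\alpha(\Gamma_p)$ of the fiber. Then, as $K_{\alpha_B}(\Gamma_B)$-modules, $K_\alpha(\Gamma)$ is isomorphic to the free $K_{\alpha_B}(\Gamma_B)$-module on $c_1,\ldots,c_m$; that is, the map $K_{\alpha_B}(\Gamma_B)^m\to K_\alpha(\Gamma)$, $(\beta_1,\ldots,\beta_m)\mapsto\sum_{k=1}^m\pi^*(\beta_k)\,c_k$, is an isomorphism of $K_{\alpha_B}(\Gamma_B)$-modules.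
   Context: Let $T$ be a compact torus, $\mathfrak t^*$ the dual of its Lie algebra, $\mathbb Z_T^*\subset\mathfrak t^*$ its weight lattice. $R(T)$ is the representation (character) ring of $T$, identified with the group ring of $\mathbb Z_T^*$: finite sums $\sum_k m_k e^{2\pi\sqrt{-1}\alpha_k}$ with $m_k\in\mathbb Z$, $\alpha_k\in\mathbb Z_T^*$. Graphs. $\Gamma=(V,E)$ is a regular ($d$-valent) graph with vertex set $V$ and set $E$ of oriented edges $e=(p,q)$ ($p$ initial, $q$ terminal vertex); each edge $e=(p,q)$ has a reverse $\overline e=(q,p)\in E$. $E_p$ is the set of edges with initial vertex $p$. A connection on $\Gamma$ is a family $\nabla=\{\nabla_e\}_{e\in E}$ of bijections $\nabla_e\colon E_p\to E_q$ (for $e=(p,q)$) with $\nabla_e(e)=\overline e$ and $\nabla_{\overline e}=\nabla_e^{-1}$. Integral GKM graph. An integral axial function on $\Gamma$ is a map $\alpha\colon E\to\mathbb Z_T^*$ such that for some connection $\nabla$ on $\Gamma$: (i) $\alpha(\overline e)=-\alpha(e)$; (ii) for each $p\in V$ the vectors $\alpha(e)$, $e\in E_p$, are pairwise linearly independent; (iii) for each $e=(p,q)\in E$ and $e'\in E_p$, $\alpha(\nabla_e(e'))-\alpha(e')$ is an integer multiple of $\alpha(e)$. An (integral) GKM graph is a pair $(\Gamma,\alpha)$ of this kind. $K$-ring. $K_\alpha(\Gamma)$ is the subring of $\mathrm{Maps}(V,R(T))$ (pointwise operations) consisting of the $f$ such that for every $e=(p,q)\in E$, $f(p)-f(q)\in(1-e^{2\pi\sqrt{-1}\alpha(e)})R(T)$.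 Its elements are called $K$-classes. It is an $R(T)$-algebra. Isomorphism of GKM graphs $(\Gamma_1,\alpha_1)$ (with values in a lattice in $\mathfrak t_1^*$) and $(\Gamma_2,\alpha_2)$ (with values in a lattice in $\mathfrak t_2^*$): a pair $(\Phi,\Psi)$ with $\Phi\colon\Gamma_1\to\Gamma_2$ a graph isomorphism and $\Psi\colon\mathfrak t_1^*\to\mathfrak t_2^*$ a linear isomorphism mapping the first lattice onto the second, such that $\alpha_2(\Phi(p),\Phi(q))=\Psi(\alpha_1(p,q))$ for every edge $(p,q)$ of $\Gamma_1$. GKM fiber bundle. Let $(\Gamma,\alpha)$, $(\Gamma_B,\alpha_B)$ be GKM graphs with axial functions in the same lattice $\mathbb Z_T^*$, with connections $\nabla$, $\nabla_B$ with which $\alpha$, $\alpha_B$ are compatible. Let $\pi\colon\Gamma\to\Gamma_B$ be a surjective morphism of graphs: $\pi$ maps $V$ onto $V_B$, and for every edge $e=(p,q)$ of $\Gamma$ either $\pi(p)=\pi(q)$ ($e$ is vertical) or $(\pi(p),\pi(q))\in E_B$ ($e$ is horizontal). Let $H_p\subset E_p$ be the set of horizontal edges at $p$, and $(d\pi)_p\colon H_p\to (E_B)_{\pi(p)}$ the induced map. $\pi$ is a GKM fiber bundle if: 1. for all $p\in V$, $(d\pi)_p$ is a bijection and $\alpha_B((d\pi)_p(e))=\alpha(e)$ for all $e\in H_p$; 2. $\nabla$ moves horizontal edges to horizontal edges and vertical edges to vertical edges, and its restriction to horizontal edges is compatible (via $d\pi$) with $\nabla_B$; 3. for $p\in V_B$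 let $V_p=\pi^{-1}(p)$ and $\Gamma_p$ the induced subgraph of $\Gamma$ on $V_p$; for an edge $(p,q)$ of $\Gamma_B$ let $\Phi_{p,q}\colon V_p\to V_q$ be the bijection with $\Phi_{p,q}(p')=q'$ iff $(p',q')$ is the horizontal edge at $p'$ with $(d\pi)_{p'}(p',q')=(p,q)$ (the lift of $(p,q)$ at $p'$). Then $\Phi_{p,q}\colon\Gamma_p\to\Gamma_q$ is a graph isomorphism, and for each lift $(p_1,q_1)$ of $(p,q)$ and each edge $(p_1,p_2)$ of $\Gamma_p$, $\nabla_{(p_1,q_1)}(p_1,p_2)=(q_1,q_2)$ where $q_2=\Phi_{p,q}(p_2)$; 4. let $\alpha_p$ be the restriction of $\alpha$ to edges of $\Gamma_p$ and $\mathfrak v_p^*\subset\mathfrak t^*$ the subspace spanned by its values; for every edge $(p,q)$ of $\Gamma_B$ there is an isomorphism of GKM graphs $\Upsilon_{p,q}=(\Phi_{p,q},\Psi_{p,q})\colon(\Gamma_p,\alpha_p)\to(\Gamma_q,\alpha_q)$, with $\Psi_{p,q}\colon\mathfrak v_p^*\to\mathfrak v_q^*$ mapping $\mathfrak v_p^*\cap\mathbb Z_T^*$ onto $\mathfrak v_q^*\cap\mathbb Z_T^*$; 5. for every edge $(p,q)$ of $\Gamma_B$ there is a function $m\colon\mathfrak v_p^*\cap\mathbb Z_T^*\to\mathbb Z$ such that $\Psi_{p,q}(x)=x+m(x)\alpha_B(p,q)$. Module structure and fibers. For $f\in K_{\alpha_B}(\Gamma_B)$, $\pi^*(f)\in K_\alpha(\Gamma)$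 is $\pi^*(f)(q)=f(\pi(q))$; via $\pi^*$, $K_\alpha(\Gamma)$ is a $K_{\alpha_B}(\Gamma_B)$-module. $K_\alpha(\Gamma_p)$ denotes the ring of maps $f\colon V_p\to R(T)$ with $f(p')-f(p'')\in(1-e^{2\pi\sqrt{-1}\alpha(p',p'')})R(T)$ for every edge $(p',p'')$ of $\Gamma_p$; it is an $R(T)$-module. *)

theory Defs
  imports
    Complex_Main
    "HOL-Library.Poly_Mapping"
    "Graph_Theory.Pair_Digraph"
    "HOL-Algebra.Module"
begin

section \<open>Weight lattice and representation ring\<close>

text \<open>The type variable \<open>'t\<close> is the dual of the Lie algebra of the torus; the torus itself
  enters only through its weight lattice, a full-rank lattice in the finite-dimensional
  real vector space \<open>'t\<close>.\<close>

definition weight_lattice :: "'t::real_vector set \<Rightarrow> bool" where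
  "weight_lattice L \<longleftrightarrow>
    (\<exists>B. finite B \<and> independent B \<and> span B = UNIV \<and>
         L = range (\<lambda>n :: 't \<Rightarrow> int. \<Sum>b\<in>B. of_int (n b) *\<^sub>R b))"

text \<open>The group ring of \<open>L\<close>: the multiplication of \<open>poly_mapping\<close> is convolution.\<close>

definition rep_ring :: "'t::real_vector set \<Rightarrow> ('t \<Rightarrow>\<^sub>0 int) ring" where
  "rep_ring L = \<lparr>carrier = {f. Poly_Mapping.keys f \<subseteq> L}, mult = (*), one = 1, zero = 0, add = (+)\<rparr>"

text \<open>The character \<open>exp (2\<pi>ix)\<close> of a weight \<open>x\<close>, as an element of the group ring.\<close>

definition echar :: "'t::real_vector \<Rightarrow> ('t \<Rightarrow>\<^sub>0 int)" where
  "echar x = Poly_Mapping.single x 1"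


section \<open>GKM graphs\<close>

text \<open>Graphs are simple: no loops, no parallel edges, every edge occurs with both orientations.
  The vertex set is not required to be finite.\<close>

definition regular_graph :: "'v pair_pre_digraph \<Rightarrow> bool" where
  "regular_graph \<Gamma> \<longleftrightarrow> pair_bidirected_digraph \<Gamma> \<and>
    (\<exists>d. \<forall>p\<in>pverts \<Gamma>. finite (out_arcs (with_proj \<Gamma>) p) \<and> out_degree (with_proj \<Gamma>) p = d)"

definition connection ::
    "'v pair_pre_digraph \<Rightarrow> ('v \<times> 'v \<Rightarrow> 'v \<times> 'v \<Rightarrow> 'v \<times> 'v) \<Rightarrow> bool" where
  "connection \<Gamma> nabla \<longleftrightarrow> (\<forall>e\<in>parcs \<Gamma>.
      bij_betw (nabla e) (out_arcs (with_proj \<Gamma>) (fst e)) (out_arcs (with_proj \<Gamma>) (snd e)) \<and>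
      nabla e e = prod.swap e \<and>
      (\<forall>e'\<in>out_arcs (with_proj \<Gamma>) (fst e). nabla (prod.swap e) (nabla e e') = e'))"

definition compatible_connection ::
    "'v pair_pre_digraph \<Rightarrow> ('v \<times> 'v \<Rightarrow> 't::real_vector) \<Rightarrow>
     ('v \<times> 'v \<Rightarrow> 'v \<times> 'v \<Rightarrow> 'v \<times> 'v) \<Rightarrow> bool" where
  "compatible_connection \<Gamma> \<alpha> nabla \<longleftrightarrow> connection \<Gamma> nabla \<and>
    (\<forall>e\<in>parcs \<Gamma>. \<forall>e'\<in>out_arcs (with_proj \<Gamma>) (fst e).
       \<exists>k::int. \<alpha> (nabla e e') - \<alpha> e' = of_int k *\<^sub>R \<alpha> e)"

text \<open>The condition \<open>\<alpha> e \<noteq> \<alpha> e'\<close> makes independence of the set \<open>{\<alpha> e, \<alpha> e'}\<close> the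
  linear independence of the pair.\<close>

definition integral_axial_function ::
    "'t::real_vector set \<Rightarrow> 'v pair_pre_digraph \<Rightarrow> ('v \<times> 'v \<Rightarrow> 't) \<Rightarrow> bool" where
  "integral_axial_function L \<Gamma> \<alpha> \<longleftrightarrow>
    \<alpha> \<in> parcs \<Gamma> \<rightarrow> L \<and>
    (\<forall>e\<in>parcs \<Gamma>. \<alpha> (prod.swap e) = - \<alpha> e) \<and>
    (\<forall>p\<in>pverts \<Gamma>. \<forall>e\<in>out_arcs (with_proj \<Gamma>) p. \<forall>e'\<in>out_arcs (with_proj \<Gamma>) p.
       e \<noteq> e' \<longrightarrow> \<alpha> e \<noteq> \<alpha> e' \<and> independent {\<alpha> e, \<alpha> e'}) \<and>
    (\<exists>nabla. compatible_connection \<Gamma> \<alpha> nabla)"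

definition gkm_graph ::
    "'t::real_vector set \<Rightarrow> 'v pair_pre_digraph \<Rightarrow> ('v \<times> 'v \<Rightarrow> 't) \<Rightarrow> bool" where
  "gkm_graph L \<Gamma> \<alpha> \<longleftrightarrow> regular_graph \<Gamma> \<and> integral_axial_function L \<Gamma> \<alpha>"

definition graph_isomorphism ::
    "'v pair_pre_digraph \<Rightarrow> 'w pair_pre_digraph \<Rightarrow> ('v \<Rightarrow> 'w) \<Rightarrow> bool" where
  "graph_isomorphism \<Gamma>\<^sub>1 \<Gamma>\<^sub>2 \<Phi> \<longleftrightarrow>
    bij_betw \<Phi> (pverts \<Gamma>\<^sub>1) (pverts \<Gamma>\<^sub>2) \<and> map_prod \<Phi> \<Phi> ` parcs \<Gamma>\<^sub>1 = parcs \<Gamma>\<^sub>2"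

text \<open>Here \<open>W\<^sub>1\<close>, \<open>W\<^sub>2\<close> are the ambient vector spaces, given as subspaces of the types \<open>'s\<close>, \<open>'t\<close>,
  and \<open>L\<^sub>1\<close>, \<open>L\<^sub>2\<close> are the lattices in them.\<close>

definition gkm_isomorphism ::
    "'s::real_vector set \<Rightarrow> 's set \<Rightarrow> 'v pair_pre_digraph \<Rightarrow> ('v \<times> 'v \<Rightarrow> 's) \<Rightarrow>
     't::real_vector set \<Rightarrow> 't set \<Rightarrow> 'w pair_pre_digraph \<Rightarrow> ('w \<times> 'w \<Rightarrow> 't) \<Rightarrow>
     ('v \<Rightarrow> 'w) \<Rightarrow> ('s \<Rightarrow> 't) \<Rightarrow> bool" where
  "gkm_isomorphism W\<^sub>1 L\<^sub>1 \<Gamma>\<^sub>1 \<alpha>\<^sub>1 W\<^sub>2 L\<^sub>2 \<Gamma>\<^sub>2 \<alpha>\<^sub>2 \<Phi> \<Psi> \<longleftrightarrow>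
    graph_isomorphism \<Gamma>\<^sub>1 \<Gamma>\<^sub>2 \<Phi> \<and>
    (\<forall>x\<in>W\<^sub>1. \<forall>y\<in>W\<^sub>1. \<Psi> (x + y) = \<Psi> x + \<Psi> y) \<and>
    (\<forall>c. \<forall>x\<in>W\<^sub>1. \<Psi> (c *\<^sub>R x) = c *\<^sub>R \<Psi> x) \<and>
    bij_betw \<Psi> W\<^sub>1 W\<^sub>2 \<and> \<Psi> ` L\<^sub>1 = L\<^sub>2 \<and>
    (\<forall>e\<in>parcs \<Gamma>\<^sub>1. \<alpha>\<^sub>2 (map_prod \<Phi> \<Phi> e) = \<Psi> (\<alpha>\<^sub>1 e))"


section \<open>GKM fiber bundles\<close>

definition vertical_edges :: "'v pair_pre_digraph \<Rightarrow> ('v \<Rightarrow> 'w) \<Rightarrow> ('v \<times> 'v) set" where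
  "vertical_edges \<Gamma> \<pi> = {e \<in> parcs \<Gamma>. \<pi> (fst e) = \<pi> (snd e)}"

definition horizontal_edges ::
    "'v pair_pre_digraph \<Rightarrow> 'w pair_pre_digraph \<Rightarrow> ('v \<Rightarrow> 'w) \<Rightarrow> ('v \<times> 'v) set" where
  "horizontal_edges \<Gamma> \<Gamma>\<^sub>B \<pi> = {e \<in> parcs \<Gamma>. map_prod \<pi> \<pi> e \<in> parcs \<Gamma>\<^sub>B}"

definition fiber :: "'v pair_pre_digraph \<Rightarrow> ('v \<Rightarrow> 'w) \<Rightarrow> 'w \<Rightarrow> 'v pair_pre_digraph" where
  "fiber \<Gamma> \<pi> p = \<lparr>pverts = {v \<in> pverts \<Gamma>. \<pi> v = p},
                   parcs = {e \<in> parcs \<Gamma>. \<pi> (fst e) = p \<and> \<pi> (snd e) = p}\<rparr>"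

text \<open>\<open>transport \<Gamma> \<Gamma>\<^sub>B \<pi> p q\<close> is the map \<open>\<Phi>\<^bsub>p,q\<^esub>\<close> from the fiber over \<open>p\<close> to the fiber over \<open>q\<close>;
  the description is unique when \<open>d\<pi>\<close> is a bijection on horizontal edges at each vertex.\<close>

definition transport ::
    "'v pair_pre_digraph \<Rightarrow> 'w pair_pre_digraph \<Rightarrow> ('v \<Rightarrow> 'w) \<Rightarrow> 'w \<Rightarrow> 'w \<Rightarrow> 'v \<Rightarrow> 'v" where
  "transport \<Gamma> \<Gamma>\<^sub>B \<pi> p q p' =
    (THE q'. (p', q') \<in> horizontal_edges \<Gamma> \<Gamma>\<^sub>B \<pi> \<and> map_prod \<pi> \<pi> (p', q') = (p, q))"

definition fiber_weight_space ::
    "'v pair_pre_digraph \<Rightarrow> ('v \<times> 'v \<Rightarrow> 't::real_vector) \<Rightarrow> ('v \<Rightarrow> 'w) \<Rightarrow> 'w \<Rightarrow> 't set" where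
  "fiber_weight_space \<Gamma> \<alpha> \<pi> p = span (\<alpha> ` parcs (fiber \<Gamma> \<pi> p))"

text \<open>The map \<open>d\<pi>\<close> on edges is \<open>map_prod \<pi> \<pi>\<close>.\<close>

locale gkm_fiber_bundle =
  fixes L :: "'t::real_vector set"
    and \<Gamma> :: "'v pair_pre_digraph" and \<alpha> :: "'v \<times> 'v \<Rightarrow> 't"
    and nabla :: "'v \<times> 'v \<Rightarrow> 'v \<times> 'v \<Rightarrow> 'v \<times> 'v"
    and \<Gamma>\<^sub>B :: "'w pair_pre_digraph" and \<alpha>\<^sub>B :: "'w \<times> 'w \<Rightarrow> 't"
    and nabla\<^sub>B :: "'w \<times> 'w \<Rightarrow> 'w \<times> 'w \<Rightarrow> 'w \<times> 'w"
    and \<pi> :: "'v \<Rightarrow> 'w"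
  assumes total: "gkm_graph L \<Gamma> \<alpha>"
    and total_connection: "compatible_connection \<Gamma> \<alpha> nabla"
    and base: "gkm_graph L \<Gamma>\<^sub>B \<alpha>\<^sub>B"
    and base_connection: "compatible_connection \<Gamma>\<^sub>B \<alpha>\<^sub>B nabla\<^sub>B"
    and surj_verts: "\<pi> ` pverts \<Gamma> = pverts \<Gamma>\<^sub>B"
    and morphism: "parcs \<Gamma> = vertical_edges \<Gamma> \<pi> \<union> horizontal_edges \<Gamma> \<Gamma>\<^sub>B \<pi>"
    and dpi_bij: "\<And>p. p \<in> pverts \<Gamma> \<Longrightarrow>
      bij_betw (map_prod \<pi> \<pi>) (horizontal_edges \<Gamma> \<Gamma>\<^sub>B \<pi> \<inter> out_arcs (with_proj \<Gamma>) p)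
        (out_arcs (with_proj \<Gamma>\<^sub>B) (\<pi> p))"
    and dpi_axial: "\<And>e. e \<in> horizontal_edges \<Gamma> \<Gamma>\<^sub>B \<pi> \<Longrightarrow> \<alpha>\<^sub>B (map_prod \<pi> \<pi> e) = \<alpha> e"
    and nabla_horizontal: "\<And>e e'. e \<in> parcs \<Gamma> \<Longrightarrow> e' \<in> horizontal_edges \<Gamma> \<Gamma>\<^sub>B \<pi> \<Longrightarrow>
      fst e' = fst e \<Longrightarrow> nabla e e' \<in> horizontal_edges \<Gamma> \<Gamma>\<^sub>B \<pi>"
    and nabla_vertical: "\<And>e e'. e \<in> parcs \<Gamma> \<Longrightarrow> e' \<in> vertical_edges \<Gamma> \<pi> \<Longrightarrow>
      fst e' = fst e \<Longrightarrow> nabla e e' \<in> vertical_edges \<Gamma> \<pi>"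
    and nabla_base: "\<And>e e'. e \<in> horizontal_edges \<Gamma> \<Gamma>\<^sub>B \<pi> \<Longrightarrow> e' \<in> horizontal_edges \<Gamma> \<Gamma>\<^sub>B \<pi> \<Longrightarrow>
      fst e' = fst e \<Longrightarrow>
      map_prod \<pi> \<pi> (nabla e e') = nabla\<^sub>B (map_prod \<pi> \<pi> e) (map_prod \<pi> \<pi> e')"
    and transport_iso: "\<And>p q. (p, q) \<in> parcs \<Gamma>\<^sub>B \<Longrightarrow>
      graph_isomorphism (fiber \<Gamma> \<pi> p) (fiber \<Gamma> \<pi> q) (transport \<Gamma> \<Gamma>\<^sub>B \<pi> p q)"
    and nabla_transport: "\<And>p q p\<^sub>1 q\<^sub>1 p\<^sub>2. (p, q) \<in> parcs \<Gamma>\<^sub>B \<Longrightarrow>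
      (p\<^sub>1, q\<^sub>1) \<in> horizontal_edges \<Gamma> \<Gamma>\<^sub>B \<pi> \<Longrightarrow> map_prod \<pi> \<pi> (p\<^sub>1, q\<^sub>1) = (p, q) \<Longrightarrow>
      (p\<^sub>1, p\<^sub>2) \<in> parcs (fiber \<Gamma> \<pi> p) \<Longrightarrow>
      nabla (p\<^sub>1, q\<^sub>1) (p\<^sub>1, p\<^sub>2) = (q\<^sub>1, transport \<Gamma> \<Gamma>\<^sub>B \<pi> p q p\<^sub>2)"
    and fiber_gkm_iso: "\<And>p q. (p, q) \<in> parcs \<Gamma>\<^sub>B \<Longrightarrow>
      \<exists>\<Psi>. gkm_isomorphism
            (fiber_weight_space \<Gamma> \<alpha> \<pi> p) (fiber_weight_space \<Gamma> \<alpha> \<pi> p \<inter> L) (fiber \<Gamma> \<pi> p) \<alpha>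
            (fiber_weight_space \<Gamma> \<alpha> \<pi> q) (fiber_weight_space \<Gamma> \<alpha> \<pi> q \<inter> L) (fiber \<Gamma> \<pi> q) \<alpha>
            (transport \<Gamma> \<Gamma>\<^sub>B \<pi> p q) \<Psi> \<and>
          (\<exists>m :: 't \<Rightarrow> int. \<forall>x \<in> fiber_weight_space \<Gamma> \<alpha> \<pi> p \<inter> L.
             \<Psi> x = x + of_int (m x) *\<^sub>R \<alpha>\<^sub>B (p, q))"


section \<open>The K-ring of a GKM graph and its module structures\<close>

definition K_ring ::
    "'t::real_vector set \<Rightarrow> 'v pair_pre_digraph \<Rightarrow> ('v \<times> 'v \<Rightarrow> 't) \<Rightarrow> ('v \<Rightarrow> ('t \<Rightarrow>\<^sub>0 int)) ring" where
  "K_ring L \<Gamma> \<alpha> =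
    \<lparr>carrier = {f \<in> pverts \<Gamma> \<rightarrow>\<^sub>E carrier (rep_ring L).
        \<forall>(p, q) \<in> parcs \<Gamma>. \<exists>r \<in> carrier (rep_ring L). f p - f q = (1 - echar (\<alpha> (p, q))) * r},
     mult = (\<lambda>f g. \<lambda>v\<in>pverts \<Gamma>. f v * g v), one = (\<lambda>v\<in>pverts \<Gamma>. 1),
     zero = (\<lambda>v\<in>pverts \<Gamma>. 0), add = (\<lambda>f g. \<lambda>v\<in>pverts \<Gamma>. f v + g v)\<rparr>"

definition with_smult :: "'b ring \<Rightarrow> ('a \<Rightarrow> 'b \<Rightarrow> 'b) \<Rightarrow> ('a, 'b) module" where
  "with_smult M sm = \<lparr>carrier = carrier M, mult = mult M, one = one M,
                      zero = zero M, add = add M, smult = sm\<rparr>"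

text \<open>The K-ring as a module over the representation ring.\<close>

definition K_module ::
    "'t::real_vector set \<Rightarrow> 'v pair_pre_digraph \<Rightarrow> ('v \<times> 'v \<Rightarrow> 't) \<Rightarrow>
     ('t \<Rightarrow>\<^sub>0 int, 'v \<Rightarrow> ('t \<Rightarrow>\<^sub>0 int)) module" where
  "K_module L \<Gamma> \<alpha> = with_smult (K_ring L \<Gamma> \<alpha>) (\<lambda>r f. \<lambda>v\<in>pverts \<Gamma>. r * f v)"

definition pullback :: "'v pair_pre_digraph \<Rightarrow> ('v \<Rightarrow> 'w) \<Rightarrow> ('w \<Rightarrow> 'r) \<Rightarrow> 'v \<Rightarrow> 'r" where
  "pullback \<Gamma> \<pi> f = (\<lambda>v\<in>pverts \<Gamma>. f (\<pi> v))"

text \<open>The K-ring of the total space as a module over the K-ring of the base.\<close>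

definition K_base_module ::
    "'t::real_vector set \<Rightarrow> 'v pair_pre_digraph \<Rightarrow> ('v \<times> 'v \<Rightarrow> 't) \<Rightarrow> ('v \<Rightarrow> 'w) \<Rightarrow>
     ('w \<Rightarrow> ('t \<Rightarrow>\<^sub>0 int), 'v \<Rightarrow> ('t \<Rightarrow>\<^sub>0 int)) module" where
  "K_base_module L \<Gamma> \<alpha> \<pi> =
     with_smult (K_ring L \<Gamma> \<alpha>) (\<lambda>\<beta> f. pullback \<Gamma> \<pi> \<beta> \<otimes>\<^bsub>K_ring L \<Gamma> \<alpha>\<^esub> f)"

text \<open>The module \<open>R\<^sup>I\<close> for a finite index set \<open>I\<close>.\<close>

definition free_module :: "('a, 'b) ring_scheme \<Rightarrow> 'i set \<Rightarrow> ('a, 'i \<Rightarrow> 'a) module" where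
  "free_module R I =
    \<lparr>carrier = I \<rightarrow>\<^sub>E carrier R,
     mult = (\<lambda>x y. \<lambda>i\<in>I. x i \<otimes>\<^bsub>R\<^esub> y i), one = (\<lambda>i\<in>I. \<one>\<^bsub>R\<^esub>),
     zero = (\<lambda>i\<in>I. \<zero>\<^bsub>R\<^esub>), add = (\<lambda>x y. \<lambda>i\<in>I. x i \<oplus>\<^bsub>R\<^esub> y i),
     smult = (\<lambda>a x. \<lambda>i\<in>I. a \<otimes>\<^bsub>R\<^esub> x i)\<rparr>"

text \<open>Bases of modules, as families indexed by a finite set \<open>I\<close>.\<close>

definition module_basis ::
    "('a, 'c) ring_scheme \<Rightarrow> ('a, 'b, 'd) module_scheme \<Rightarrow> 'i set \<Rightarrow> ('i \<Rightarrow> 'b) \<Rightarrow> bool" where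
  "module_basis R M I b \<longleftrightarrow> finite I \<and> b \<in> I \<rightarrow> carrier M \<and>
    (\<forall>x\<in>carrier M. \<exists>a \<in> I \<rightarrow> carrier R. x = (\<Oplus>\<^bsub>M\<^esub>i\<in>I. a i \<odot>\<^bsub>M\<^esub> b i)) \<and>
    (\<forall>a \<in> I \<rightarrow> carrier R. (\<Oplus>\<^bsub>M\<^esub>i\<in>I. a i \<odot>\<^bsub>M\<^esub> b i) = \<zero>\<^bsub>M\<^esub> \<longrightarrow> (\<forall>i\<in>I. a i = \<zero>\<^bsub>R\<^esub>))"

definition module_isomorphism ::
    "('a, 'c) ring_scheme \<Rightarrow> ('a, 'b, 'd) module_scheme \<Rightarrow> ('a, 'e, 'f) module_scheme \<Rightarrow>
     ('b \<Rightarrow> 'e) \<Rightarrow> bool" where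
  "module_isomorphism R M N h \<longleftrightarrow> Module.module R M \<and> Module.module R N \<and>
    bij_betw h (carrier M) (carrier N) \<and>
    (\<forall>x\<in>carrier M. \<forall>y\<in>carrier M. h (x \<oplus>\<^bsub>M\<^esub> y) = h x \<oplus>\<^bsub>N\<^esub> h y) \<and>
    (\<forall>a\<in>carrier R. \<forall>x\<in>carrier M. h (a \<odot>\<^bsub>M\<^esub> x) = a \<odot>\<^bsub>N\<^esub> h x)"

end

theory Submission
  imports Defs
begin

text \<open>On each fiber a class \<open>f\<close> on the total space is a unique combination of the \<open>c\<^sub>k\<close>, with
  coefficients \<open>\<beta>\<^sub>k(p)\<close> depending on the base vertex \<open>p\<close>; the point is that each \<open>\<beta>\<^sub>k\<close> is a class on the
  base. Comparing \<open>f\<close> along the horizontal lifts of a base edge \<open>(p, q)\<close> of weight \<open>e\<close> shows that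
  \<open>\<Sum>\<^sub>k (\<beta>\<^sub>k(p) - \<beta>\<^sub>k(q)) c\<^sub>k\<close> is divisible by \<open>1 - echar e\<close> at every vertex of the fiber over \<open>p\<close>. The
  quotient is again a class on the fiber, because \<open>1 - echar e\<close> is not a zero divisor modulo
  \<open>1 - echar b\<close> for the weight \<open>b\<close> of a vertical edge, which is linearly independent of \<open>e\<close>. Expanding
  the quotient in the basis shows that the coefficients \<open>\<beta>\<^sub>k(p) - \<beta>\<^sub>k(q)\<close> are themselves divisible.\<close>

section \<open>Divisibility in the representation ring\<close>

text \<open>Containing \<open>0\<close> and being closed under addition makes the elements of the
  group ring with support in \<open>L\<close> a subring.\<close>

locale weight_group =
  fixes L :: "'t::real_vector set"
  assumes zero_mem: "0 \<in> L"
    and add_mem: "\<And>x y. x \<in> L \<Longrightarrow> y \<in> L \<Longrightarrow> x + y \<in> L"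
    and uminus_mem: "\<And>x. x \<in> L \<Longrightarrow> - x \<in> L"

lemma weight_lattice_imp_weight_group:
  assumes "weight_lattice L"
  shows "weight_group L"
proof -
  obtain B where L: "L = range (\<lambda>n :: _ \<Rightarrow> int. \<Sum>b\<in>B. of_int (n b) *\<^sub>R b)"
    using assms unfolding weight_lattice_def by blast
  show ?thesis
  proof
    show "0 \<in> L"
      unfolding L by (rule range_eqI[of _ _ "\<lambda>_. 0"]) simp
  next
    fix x y assume "x \<in> L" "y \<in> L"
    then obtain n k :: "_ \<Rightarrow> int"
      where "x = (\<Sum>b\<in>B. of_int (n b) *\<^sub>R b)" "y = (\<Sum>b\<in>B. of_int (k b) *\<^sub>R b)"
      unfolding L by blast
    then show "x + y \<in> L"
      unfolding L
      by (intro range_eqI[of _ _ "\<lambda>b. n b + k b"]) (simp add: sum.distrib scaleR_add_left)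
  next
    fix x assume "x \<in> L"
    then obtain n :: "_ \<Rightarrow> int" where "x = (\<Sum>b\<in>B. of_int (n b) *\<^sub>R b)"
      unfolding L by blast
    then show "- x \<in> L"
      unfolding L by (intro range_eqI[of _ _ "\<lambda>b. - n b"]) (simp add: sum_negf)
  qed
qed

section \<open>Supports under translation and truncation\<close>

lemma lookup_echar_power_mult:
  "Poly_Mapping.lookup (echar x ^ n * f) y = Poly_Mapping.lookup f (y - of_nat n *\<^sub>R x)"
proof (induction n arbitrary: y)
  case (Suc n)
  \<comment> \<open>Convolution with a point mass at \<open>x\<close> leaves only the summand whose
    second index is \<open>y - x\<close>.\<close>
  have shift: "Poly_Mapping.lookup (echar x * g) y = Poly_Mapping.lookup g (y - x)" for g y
  proof -
    have "(x + q = y) = (q = y - x)" for q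
      by (auto simp: algebra_simps)
    moreover have "Poly_Mapping.lookup (echar x * g) y =
        (\<Sum>a. (\<Sum>q. Poly_Mapping.lookup g q when y = a + q) when a = x)"
      unfolding lookup_mult echar_def
      by (rule Sum_any.cong) (auto simp: lookup_single when_def)
    ultimately show ?thesis
      by (simp add: eq_commute[of y])
  qed
  show ?case
    by (simp add: Suc mult.assoc shift scaleR_add_left diff_diff_eq)
qed simp

lemma lookup_echar_mult:
  "Poly_Mapping.lookup (echar x * f) y = Poly_Mapping.lookup f (y - x)"
  using lookup_echar_power_mult[of x 1 f y] by simp

text \<open>Projection of the group ring onto the functions supported on \<open>C\<close>. It is
  applied to a union of cosets of the integer multiples of a weight, where it commutes with
  translation by that weight.\<close>

definition restrict_keys :: "'a set \<Rightarrow> ('a \<Rightarrow>\<^sub>0 'b) \<Rightarrow> ('a \<Rightarrow>\<^sub>0 'b::comm_monoid_add)" where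
  "restrict_keys C f = (\<Sum>x\<in>Poly_Mapping.keys f \<inter> C. Poly_Mapping.single x (Poly_Mapping.lookup f x))"

lemma lookup_restrict_keys:
  "Poly_Mapping.lookup (restrict_keys C f) x = (if x \<in> C then Poly_Mapping.lookup f x else 0)"
  by (auto simp: restrict_keys_def lookup_sum lookup_single when_def sum.delta in_keys_iff)

text \<open>The equation is a linear relation with coefficients \<open>n\<close> and
  \<open>- k\<close>. In this integral form, independence says that distinct integer multiples of
  \<open>a\<close> lie in distinct cosets of \<int> b.\<close>

lemma independent_pair_int:
  fixes a b :: "'t::real_vector"
  assumes "independent {a, b}" and "a \<noteq> b" and "of_int n *\<^sub>R a = of_int k *\<^sub>R b"
  shows "n = (0::int)"
proof -
  have "(\<Sum>v\<in>{a, b}. (if v = a then of_int n else - of_int k) *\<^sub>R v) = 0"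
    using assms(2,3) by auto
  from independentD[OF assms(1) _ _ this, of a] show ?thesis
    by simp
qed

section \<open>The ring R(T) and the ideals of the edge conditions\<close>

context weight_group
begin

abbreviation R where "R \<equiv> carrier (rep_ring L)"

lemma in_R: "f \<in> R \<longleftrightarrow> Poly_Mapping.keys f \<subseteq> L"
  by (simp add: rep_ring_def)

lemma zero_R [simp]: "0 \<in> R" and one_R [simp]: "1 \<in> R"
  by (auto simp: in_R zero_mem)

lemma add_R [intro]: "f \<in> R \<Longrightarrow> g \<in> R \<Longrightarrow> f + g \<in> R"
  unfolding in_R using Poly_Mapping.keys_add[of f g] by blast

lemma uminus_R [intro]: "f \<in> R \<Longrightarrow> - f \<in> R"
  by (simp add: in_R)

lemma diff_R [intro]: "f \<in> R \<Longrightarrow> g \<in> R \<Longrightarrow> f - g \<in> R"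
  using add_R[of f "- g"] uminus_R[of g] by simp

lemma mult_R [intro]: "f \<in> R \<Longrightarrow> g \<in> R \<Longrightarrow> f * g \<in> R"
  unfolding in_R using keys_mult[of f g] add_mem by blast

lemma sum_R [intro]: "(\<And>i. i \<in> I \<Longrightarrow> F i \<in> R) \<Longrightarrow> sum F I \<in> R"
  by (induction I rule: infinite_finite_induct) auto

lemma echar_R [intro]: "x \<in> L \<Longrightarrow> echar x \<in> R"
  by (simp add: in_R echar_def)

lemma power_R [intro]: "f \<in> R \<Longrightarrow> f ^ n \<in> R"
  by (induction n) auto

text \<open>The principal ideal of \<open>R\<close> generated by \<open>1 - echar b\<close>. The
  quotient is taken in \<open>R\<close> explicitly, since divisibility in the type itself says
  nothing about the weights of the quotient.\<close>

definition euler_multiples :: "'t \<Rightarrow> ('t \<Rightarrow>\<^sub>0 int) set" where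
  "euler_multiples b = (\<lambda>r. (1 - echar b) * r) ` R"

lemma zero_multiples [simp]: "0 \<in> euler_multiples b"
  unfolding euler_multiples_def by (rule image_eqI[of _ _ 0]) auto

lemma add_multiples [intro]:
  assumes "f \<in> euler_multiples b" and "g \<in> euler_multiples b"
  shows "f + g \<in> euler_multiples b"
proof -
  obtain r s where "r \<in> R" "s \<in> R" "f = (1 - echar b) * r" "g = (1 - echar b) * s"
    using assms unfolding euler_multiples_def by blast
  then show ?thesis
    unfolding euler_multiples_def
    by (intro image_eqI[of _ _ "r + s"]) (auto simp: distrib_left)
qed

lemma mult_multiples [intro]:
  assumes "f \<in> R" and "g \<in> euler_multiples b"
  shows "f * g \<in> euler_multiples b"
proof -
  obtain r where "r \<in> R" "g = (1 - echar b) * r"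
    using assms unfolding euler_multiples_def by blast
  then show ?thesis
    unfolding euler_multiples_def using assms(1)
    by (intro image_eqI[of _ _ "f * r"]) (auto simp: mult_ac)
qed

lemma uminus_multiples [intro]: "f \<in> euler_multiples b \<Longrightarrow> - f \<in> euler_multiples b"
  using mult_multiples[of "- 1" f b] uminus_R[OF one_R] by simp

lemma diff_multiples [intro]:
  "f \<in> euler_multiples b \<Longrightarrow> g \<in> euler_multiples b \<Longrightarrow> f - g \<in> euler_multiples b"
  using add_multiples[of f b "- g"] uminus_multiples[of g b] by simp

lemma sum_multiples [intro]:
  "(\<And>i. i \<in> I \<Longrightarrow> F i \<in> euler_multiples b) \<Longrightarrow> sum F I \<in> euler_multiples b"
  by (induction I rule: infinite_finite_induct) auto

text \<open>Modulo \<open>1 - echar b\<close>, multiplication by a suitable power \<open>echar a ^ N\<close> moves the support of \<open>g\<close>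
  off all cosets of \<open>\<int> b\<close> that it meets. So \<open>g\<close> is recovered from \<open>(1 - echar a ^ N) * g\<close>, which is a
  multiple of \<open>1 - echar b\<close>, by restriction to these cosets, and restriction to a union of cosets
  commutes with multiplication by \<open>1 - echar b\<close>.\<close>

lemma cancel_mod_multiples:
  assumes a: "a \<in> L" and g: "g \<in> R"
    and indep: "\<And>n k :: int. of_int n *\<^sub>R a = of_int k *\<^sub>R b \<Longrightarrow> n = 0"
    and mem: "(1 - echar a) * g \<in> euler_multiples b"
  shows "g \<in> euler_multiples b"
proof -
  define K where "K = Poly_Mapping.keys g"
  define C where "C = {y. \<exists>x\<in>K. \<exists>k::int. y = x + of_int k *\<^sub>R b}"
  have C_shift: "x - b \<in> C \<longleftrightarrow> x \<in> C" for x
  proof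
    assume "x - b \<in> C"
    then obtain y k where "y \<in> K" "x - b = y + of_int k *\<^sub>R b" unfolding C_def by blast
    then have "y \<in> K" "x = y + of_int (k + 1) *\<^sub>R b" by (auto simp: algebra_simps)
    then show "x \<in> C" unfolding C_def by blast
  next
    assume "x \<in> C"
    then obtain y k where "y \<in> K" "x = y + of_int k *\<^sub>R b" unfolding C_def by blast
    then have "y \<in> K" "x - b = y + of_int (k - 1) *\<^sub>R b" by (auto simp: algebra_simps)
    then show "x - b \<in> C" unfolding C_def by blast
  qed
  \<comment> \<open>These are the exponents \<open>N\<close> for which translation by
    \<open>N\<close> times \<open>a\<close> moves \<open>x\<close> into the coset of
    \<open>y\<close>. Two of them would give a relation between \<open>a\<close> and
    \<open>b\<close>, so there is at most one for each pair, and the finite support \<open>K\<close>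
    rules out only finitely many \<open>N\<close>.\<close>
  define bad where "bad = (\<lambda>x y. {N::nat. \<exists>k::int. x + of_nat N *\<^sub>R a = y + of_int k *\<^sub>R b})"
  have "finite (bad x y)" for x y
  proof -
    have "N = M" if NM: "N \<in> bad x y" "M \<in> bad x y" for N M
    proof -
      obtain k l :: int where "x + of_nat N *\<^sub>R a = y + of_int k *\<^sub>R b"
          "x + of_nat M *\<^sub>R a = y + of_int l *\<^sub>R b"
        using NM unfolding bad_def by blast
      then have "of_nat N *\<^sub>R a - of_nat M *\<^sub>R a = of_int k *\<^sub>R b - of_int l *\<^sub>R b"
        by (metis add_diff_cancel_left)
      then have "of_int (int N - int M) *\<^sub>R a = of_int (k - l) *\<^sub>R b"
        by (simp add: scaleR_diff_left)
      from indep[OF this] show ?thesis by simp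
    qed
    then have "bad x y \<subseteq> {N}" if "N \<in> bad x y" for N
      using that by blast
    then show ?thesis
      by (metis finite.emptyI finite.insertI finite_subset subsetI)
  qed
  then have "finite (\<Union>x\<in>K. \<Union>y\<in>K. bad x y)"
    by (simp add: K_def)
  then obtain N where N: "N \<notin> (\<Union>x\<in>K. \<Union>y\<in>K. bad x y)"
    by (meson ex_new_if_finite infinite_UNIV_nat)
  \<comment> \<open>The geometric sum exhibits \<open>1 - echar a\<close> as a factor of
    \<open>1 - echar a ^ N\<close>, so the hypothesis passes to the power.\<close>
  have "(1 - echar a ^ N) * g = (\<Sum>i<N. echar a ^ i) * ((1 - echar a) * g)"
    by (simp add: one_diff_power_eq mult_ac)
  also have "\<dots> \<in> euler_multiples b"
    using mem a by auto
  finally obtain r where r: "r \<in> R" "(1 - echar a ^ N) * g = (1 - echar b) * r"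
    unfolding euler_multiples_def by blast
  have "g = (1 - echar b) * restrict_keys C r"
  proof (rule poly_mapping_eqI)
    fix x
    have "Poly_Mapping.lookup ((1 - echar b) * restrict_keys C r) x =
        (if x \<in> C then Poly_Mapping.lookup ((1 - echar b) * r) x else 0)"
      by (simp add: left_diff_distrib lookup_minus lookup_echar_mult lookup_restrict_keys C_shift)
    also have "\<dots> = (if x \<in> C then Poly_Mapping.lookup g x
        - Poly_Mapping.lookup g (x - of_nat N *\<^sub>R a) else 0)"
      unfolding r(2)[symmetric]
      by (simp add: left_diff_distrib lookup_minus lookup_echar_power_mult)
    \<comment> \<open>On \<open>C\<close> the translated term vanishes, because a support point
      there would make \<open>N\<close> bad. Off \<open>C\<close> both sides vanish, because the
      support of \<open>g\<close> lies in \<open>C\<close>.\<close>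
    also have "\<dots> = Poly_Mapping.lookup g x"
    proof (cases "x \<in> C")
      case True
      then obtain y k where "y \<in> K" "x = y + of_int k *\<^sub>R b" unfolding C_def by blast
      have "x' + of_nat N *\<^sub>R a \<noteq> y + of_int k *\<^sub>R b" if "x' \<in> K" for x'
        using N that \<open>y \<in> K\<close> unfolding bad_def by blast
      from this[of "x - of_nat N *\<^sub>R a"] have "x - of_nat N *\<^sub>R a \<notin> K"
        using \<open>x = y + of_int k *\<^sub>R b\<close> by auto
      then show ?thesis using True by (simp add: K_def in_keys_iff)
    next
      case False
      have "K \<subseteq> C"
        unfolding C_def by (auto intro!: bexI exI[of _ 0])
      with False show ?thesis by (auto simp: K_def in_keys_iff)
    qed
    finally show "Poly_Mapping.lookup g x =
      Poly_Mapping.lookup ((1 - echar b) * restrict_keys C r) x" by simp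
  qed
  \<comment> \<open>Truncation does not enlarge the support, so the quotient keeps its weights in
    \<open>L\<close>.\<close>
  moreover have "restrict_keys C r \<in> R"
    using r(1) by (auto simp: in_R in_keys_iff lookup_restrict_keys split: if_splits)
  ultimately show ?thesis
    unfolding euler_multiples_def by blast
qed

end

section \<open>Module structures on K-rings\<close>

text \<open>Only the additive part of a record matters here, so the group structure passes from a
  ring to the modules that \<open>with_smult\<close> builds on it.\<close>

lemma abelian_group_cong:
  assumes "abelian_group M"
    and eq: "carrier N = carrier M" "add N = add M" "zero N = zero M"
  shows "abelian_group N"
proof -
  interpret abelian_group M by fact
  show ?thesis
  proof (rule abelian_groupI)
    show "\<exists>y\<in>carrier N. y \<oplus>\<^bsub>N\<^esub> x = \<zero>\<^bsub>N\<^esub>" if "x \<in> carrier N" for x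
      using that by (intro bexI[of _ "\<ominus>\<^bsub>M\<^esub> x"]) (simp_all add: eq l_neg)
  qed (simp_all add: eq a_ac)
qed

text \<open>A sum formed in a module record is a different term from the sum in the underlying ring;
  by induction on \<open>I\<close> the two agree.\<close>

lemma finsum_structure_cong:
  assumes M: "abelian_group M"
    and eq: "carrier N = carrier M" "add N = add M" "zero N = zero M"
    and "finite I" and "\<And>i. i \<in> I \<Longrightarrow> F i \<in> carrier M"
  shows "finsum N F I = finsum M F I"
proof -
  interpret M: abelian_group M by fact
  interpret N: abelian_group N by (rule abelian_group_cong[OF M eq])
  show ?thesis
    using assms(5,6)
  proof (induction I rule: finite_induct)
    case (insert i I)
    then have "F \<in> I \<rightarrow> carrier M" "F i \<in> carrier M" by auto
    with insert show ?case
      by (simp add: M.finsum_insert N.finsum_insert eq)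
  qed (simp add: eq)
qed

lemma with_smult_simps:
  "carrier (with_smult M sm) = carrier M" "add (with_smult M sm) = add M"
  "zero (with_smult M sm) = zero M" "smult (with_smult M sm) = sm"
  by (simp_all add: with_smult_def)

lemma restrict_eqI:
  "x \<in> PiE V A \<Longrightarrow> (\<And>v. v \<in> V \<Longrightarrow> F v = x v) \<Longrightarrow> restrict F V = x"
  by (metis PiE_restrict restrict_ext)

lemma abelian_group_free_module:
  assumes "abelian_group M"
  shows "abelian_group (free_module M I)"
proof -
  interpret abelian_group M by fact
  have mem [simp]: "x i \<in> carrier M" if "x \<in> I \<rightarrow>\<^sub>E carrier M" "i \<in> I" for x i
    using that by (rule PiE_mem)
  show ?thesis
  proof (rule abelian_groupI)
    fix x assume x: "x \<in> carrier (free_module M I)"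
    then have "(\<lambda>i\<in>I. \<ominus>\<^bsub>M\<^esub> x i) \<in> carrier (free_module M I)"
      "(\<lambda>i\<in>I. \<ominus>\<^bsub>M\<^esub> x i) \<oplus>\<^bsub>free_module M I\<^esub> x = \<zero>\<^bsub>free_module M I\<^esub>"
      by (auto simp: free_module_def l_neg intro!: restrict_ext)
    then show "\<exists>y\<in>carrier (free_module M I). y \<oplus>\<^bsub>free_module M I\<^esub> x = \<zero>\<^bsub>free_module M I\<^esub>"
      by blast
    show "\<zero>\<^bsub>free_module M I\<^esub> \<oplus>\<^bsub>free_module M I\<^esub> x = x"
      using x by (auto simp: free_module_def intro!: restrict_eqI)
  qed (auto simp: free_module_def a_ac intro!: restrict_ext)
qed

lemma module_free_module:
  assumes "cring S"
  shows "Module.module S (free_module S I)"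
proof -
  interpret cring S by fact
  have mem [simp]: "x i \<in> carrier S" if "x \<in> I \<rightarrow>\<^sub>E carrier S" "i \<in> I" for x i
    using that by (rule PiE_mem)
  show ?thesis
  proof (rule moduleI[OF assms abelian_group_free_module[OF abelian_group_axioms]])
    show "\<one>\<^bsub>S\<^esub> \<odot>\<^bsub>free_module S I\<^esub> x = x" if "x \<in> carrier (free_module S I)" for x
      using that by (auto simp: free_module_def intro!: restrict_eqI)
  qed (auto simp: free_module_def l_distr r_distr m_assoc intro!: restrict_ext)
qed

section \<open>The ring of K-classes\<close>

context weight_group
begin

text \<open>Ideal membership replaces the explicit quotient, so the closure properties of the ideals
  can be used edge by edge.\<close>

lemma K_ring_carrier:
  "f \<in> carrier (K_ring L G a) \<longleftrightarrow> f \<in> pverts G \<rightarrow>\<^sub>E R \<and>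
    (\<forall>p q. (p, q) \<in> parcs G \<longrightarrow> f p - f q \<in> euler_multiples (a (p, q)))"
  by (simp add: K_ring_def euler_multiples_def image_iff Ball_def)

lemma K_ring_apply_R: "f \<in> carrier (K_ring L G a) \<Longrightarrow> v \<in> pverts G \<Longrightarrow> f v \<in> R"
  by (auto simp: K_ring_carrier PiE_mem)

lemma K_ring_edge:
  "f \<in> carrier (K_ring L G a) \<Longrightarrow> (p, q) \<in> parcs G \<Longrightarrow> f p - f q \<in> euler_multiples (a (p, q))"
  by (auto simp: K_ring_carrier)

lemma K_ring_eqI:
  "f \<in> carrier (K_ring L G a) \<Longrightarrow> g \<in> carrier (K_ring L G a) \<Longrightarrow>
    (\<And>v. v \<in> pverts G \<Longrightarrow> f v = g v) \<Longrightarrow> f = g"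
  unfolding K_ring_carrier by (elim conjE, rule PiE_ext)

context
  fixes G :: "'v pair_pre_digraph" and a :: "'v \<times> 'v \<Rightarrow> 't"
  assumes G: "pair_wf_digraph G"
begin

text \<open>Well-formedness puts both ends of an edge among the vertices, where restriction leaves
  \<open>F\<close> unchanged; the edge conditions can thus be checked on \<open>F\<close>
  itself.\<close>

lemma K_ring_restrictI:
  assumes "\<And>v. v \<in> pverts G \<Longrightarrow> F v \<in> R"
    and "\<And>p q. (p, q) \<in> parcs G \<Longrightarrow> F p - F q \<in> euler_multiples (a (p, q))"
  shows "restrict F (pverts G) \<in> carrier (K_ring L G a)"
  using assms pair_wf_digraph.in_arcsD1[OF G] pair_wf_digraph.in_arcsD2[OF G]
  by (auto simp: K_ring_carrier)

lemma K_ring_add: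
  assumes f: "f \<in> carrier (K_ring L G a)" and g: "g \<in> carrier (K_ring L G a)"
  shows "(\<lambda>v\<in>pverts G. f v + g v) \<in> carrier (K_ring L G a)"
proof (rule K_ring_restrictI)
  fix p q assume "(p, q) \<in> parcs G"
  then have "(f p - f q) + (g p - g q) \<in> euler_multiples (a (p, q))"
    by (intro add_multiples K_ring_edge[OF f] K_ring_edge[OF g])
  then show "(f p + g p) - (f q + g q) \<in> euler_multiples (a (p, q))"
    by (simp add: algebra_simps)
qed (intro add_R K_ring_apply_R[OF f] K_ring_apply_R[OF g])

lemma K_ring_mult:
  assumes f: "f \<in> carrier (K_ring L G a)" and g: "g \<in> carrier (K_ring L G a)"
  shows "(\<lambda>v\<in>pverts G. f v * g v) \<in> carrier (K_ring L G a)"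
proof (rule K_ring_restrictI)
  fix p q assume e: "(p, q) \<in> parcs G"
  then have "g p \<in> R" "f q \<in> R"
    using K_ring_apply_R[OF f] K_ring_apply_R[OF g] pair_wf_digraph.in_arcsD1[OF G]
      pair_wf_digraph.in_arcsD2[OF G] by simp_all
  \<comment> \<open>A Leibniz rule: the difference of products splits into differences of the
    factors, each with a coefficient in \<open>R\<close>.\<close>
  then have "g p * (f p - f q) + f q * (g p - g q) \<in> euler_multiples (a (p, q))"
    by (intro add_multiples mult_multiples K_ring_edge[OF f e] K_ring_edge[OF g e])
  then show "f p * g p - f q * g q \<in> euler_multiples (a (p, q))"
    by (simp add: algebra_simps)
qed (intro mult_R K_ring_apply_R[OF f] K_ring_apply_R[OF g])

lemma K_ring_uminus:
  assumes f: "f \<in> carrier (K_ring L G a)"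
  shows "(\<lambda>v\<in>pverts G. - f v) \<in> carrier (K_ring L G a)"
proof (rule K_ring_restrictI)
  fix p q assume "(p, q) \<in> parcs G"
  then have "- (f p - f q) \<in> euler_multiples (a (p, q))"
    by (intro uminus_multiples K_ring_edge[OF f])
  then show "- f p - - f q \<in> euler_multiples (a (p, q))"
    by simp
qed (intro uminus_R K_ring_apply_R[OF f])

lemma K_ring_const: "r \<in> R \<Longrightarrow> (\<lambda>v\<in>pverts G. r) \<in> carrier (K_ring L G a)"
  by (rule K_ring_restrictI) auto

lemma K_ring_ops:
  "mult (K_ring L G a) = (\<lambda>f g. \<lambda>v\<in>pverts G. f v * g v)"
  "one (K_ring L G a) = (\<lambda>v\<in>pverts G. 1)"
  "zero (K_ring L G a) = (\<lambda>v\<in>pverts G. 0)"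
  "add (K_ring L G a) = (\<lambda>f g. \<lambda>v\<in>pverts G. f v + g v)"
  by (simp_all add: K_ring_def)

lemma cring_K_ring: "cring (K_ring L G a)"
proof (rule cringI)
  have eqI: "restrict F (pverts G) = f"
    if "f \<in> carrier (K_ring L G a)" "\<And>v. v \<in> pverts G \<Longrightarrow> F v = f v" for f F
    using that restrict_eqI unfolding K_ring_carrier by metis
  show "abelian_group (K_ring L G a)"
  proof (rule abelian_groupI)
    fix x assume x: "x \<in> carrier (K_ring L G a)"
    show "\<exists>y\<in>carrier (K_ring L G a). y \<oplus>\<^bsub>K_ring L G a\<^esub> x = \<zero>\<^bsub>K_ring L G a\<^esub>"
      by (rule bexI[OF _ K_ring_uminus[OF x]]) (simp add: K_ring_ops fun_eq_iff)
    show "\<zero>\<^bsub>K_ring L G a\<^esub> \<oplus>\<^bsub>K_ring L G a\<^esub> x = x"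
      using x by (simp add: K_ring_ops eqI)
  qed (simp_all add: K_ring_ops K_ring_add K_ring_const fun_eq_iff add_ac)
  show "comm_monoid (K_ring L G a)"
  proof (rule comm_monoidI)
    show "\<one>\<^bsub>K_ring L G a\<^esub> \<otimes>\<^bsub>K_ring L G a\<^esub> x = x" if "x \<in> carrier (K_ring L G a)" for x
      using that by (simp add: K_ring_ops eqI)
  qed (simp_all add: K_ring_ops K_ring_mult K_ring_const fun_eq_iff mult_ac)
qed (simp add: K_ring_ops fun_eq_iff distrib_right)

lemma abelian_group_K_ring: "abelian_group (K_ring L G a)"
  using cring_K_ring by (simp add: cring.axioms(1) ring.is_abelian_group)

text \<open>Addition of classes is pointwise, hence so are finite sums; linear combinations can then
  be compared vertex by vertex.\<close>

lemma finsum_K_ring: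
  assumes "finite I" and "\<And>i. i \<in> I \<Longrightarrow> F i \<in> carrier (K_ring L G a)"
  shows "(\<Oplus>\<^bsub>K_ring L G a\<^esub>i\<in>I. F i) = (\<lambda>v\<in>pverts G. \<Sum>i\<in>I. F i v)"
proof -
  interpret cring "K_ring L G a" by (rule cring_K_ring)
  show ?thesis
    using assms
  proof (induction I rule: finite_induct)
    case (insert i I)
    then have "(\<Oplus>\<^bsub>K_ring L G a\<^esub>i\<in>insert i I. F i) = F i \<oplus>\<^bsub>K_ring L G a\<^esub> (\<Oplus>\<^bsub>K_ring L G a\<^esub>i\<in>I. F i)"
      by (intro finsum_insert) auto
    with insert show ?case
      by (auto simp: K_ring_ops)
  qed (simp add: K_ring_ops)
qed

end

end

lemma pair_wf_digraph_fiber: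
  assumes "pair_wf_digraph \<Gamma>"
  shows "pair_wf_digraph (fiber \<Gamma> \<pi> p)"
  using assms unfolding pair_wf_digraph_def fiber_def by auto

section \<open>Bases of a K-ring and divisibility of coordinates\<close>

context weight_group
begin

text \<open>Unpacks the abstract basis property into values at vertices: the coordinates are
  constants in \<open>R\<close>, and a linear relation is one that holds at all vertices
  simultaneously.\<close>

lemma module_basis_K_moduleD:
  assumes G: "pair_wf_digraph G"
    and basis: "module_basis (rep_ring L) (K_module L G a) I b"
  shows "finite I"
    and "\<And>k. k \<in> I \<Longrightarrow> b k \<in> carrier (K_ring L G a)"
    and "\<And>f. f \<in> carrier (K_ring L G a) \<Longrightarrow>
      \<exists>r \<in> I \<rightarrow> R. \<forall>v\<in>pverts G. f v = (\<Sum>k\<in>I. r k * b k v)"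
    and "\<And>r. r \<in> I \<rightarrow> R \<Longrightarrow> (\<And>v. v \<in> pverts G \<Longrightarrow> (\<Sum>k\<in>I. r k * b k v) = 0) \<Longrightarrow>
      (\<And>k. k \<in> I \<Longrightarrow> r k = 0)"
proof -
  let ?M = "K_module L G a"
  have carrier: "carrier ?M = carrier (K_ring L G a)"
    by (simp add: K_module_def with_smult_simps)
  show fin: "finite I"
    using basis by (simp add: module_basis_def)
  show b: "b k \<in> carrier (K_ring L G a)" if "k \<in> I" for k
    using basis that by (auto simp: module_basis_def carrier)
  have comb: "(\<Oplus>\<^bsub>?M\<^esub>k\<in>I. r k \<odot>\<^bsub>?M\<^esub> b k) = (\<lambda>v\<in>pverts G. \<Sum>k\<in>I. r k * b k v)"
    if r: "r \<in> I \<rightarrow> R" for r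
  proof -
    have "r k \<odot>\<^bsub>?M\<^esub> b k = (\<lambda>v\<in>pverts G. r k * b k v)" for k
      by (simp add: K_module_def with_smult_simps)
    \<comment> \<open>Scaling by \<open>r k\<close> is multiplication by a constant class, so
      closure under products applies.\<close>
    moreover have "(\<lambda>v\<in>pverts G. r k * b k v) \<in> carrier (K_ring L G a)" if "k \<in> I" for k
      using K_ring_mult[OF G K_ring_const[OF G] b[OF that], of "r k"] r that
      by (auto cong: restrict_cong)
    ultimately have mem: "r k \<odot>\<^bsub>?M\<^esub> b k \<in> carrier (K_ring L G a)" if "k \<in> I" for k
      using that by simp
    have "(\<Oplus>\<^bsub>?M\<^esub>k\<in>I. r k \<odot>\<^bsub>?M\<^esub> b k) = (\<Oplus>\<^bsub>K_ring L G a\<^esub>k\<in>I. r k \<odot>\<^bsub>?M\<^esub> b k)"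
      unfolding K_module_def
      by (rule finsum_structure_cong[OF abelian_group_K_ring[OF G]])
        (use fin mem in \<open>simp_all add: with_smult_simps K_module_def\<close>)
    also have "\<dots> = (\<lambda>v\<in>pverts G. \<Sum>k\<in>I. (r k \<odot>\<^bsub>?M\<^esub> b k) v)"
      by (rule finsum_K_ring[OF G fin mem])
    also have "\<dots> = (\<lambda>v\<in>pverts G. \<Sum>k\<in>I. r k * b k v)"
      by (intro restrict_ext) (simp add: K_module_def with_smult_simps)
    finally show ?thesis .
  qed
  show "\<exists>r \<in> I \<rightarrow> R. \<forall>v\<in>pverts G. f v = (\<Sum>k\<in>I. r k * b k v)"
    if f: "f \<in> carrier (K_ring L G a)" for f
  proof -
    obtain r where "r \<in> I \<rightarrow> R" "f = (\<Oplus>\<^bsub>?M\<^esub>k\<in>I. r k \<odot>\<^bsub>?M\<^esub> b k)"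
      using basis f unfolding module_basis_def carrier by blast
    then show ?thesis
      using comb by (intro bexI[of _ r]) simp_all
  qed
  show "r k = 0"
    if r: "r \<in> I \<rightarrow> R" and zero: "\<And>v. v \<in> pverts G \<Longrightarrow> (\<Sum>k\<in>I. r k * b k v) = 0"
      and k: "k \<in> I" for r k
  proof -
    have "(\<Oplus>\<^bsub>?M\<^esub>k\<in>I. r k \<odot>\<^bsub>?M\<^esub> b k) = (\<lambda>v\<in>pverts G. 0)"
      unfolding comb[OF r] using zero by (intro restrict_ext)
    also have "\<dots> = \<zero>\<^bsub>?M\<^esub>"
      by (simp add: K_module_def with_smult_simps K_ring_ops[OF G])
    finally have "\<forall>i\<in>I. r i = \<zero>\<^bsub>rep_ring L\<^esub>"
      using basis r unfolding module_basis_def by blast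
    then show ?thesis
      using k by (simp add: rep_ring_def)
  qed
qed

text \<open>Dividing the combination by \<open>1 - echar e\<close> at each vertex gives again a
  class, because this factor cancels modulo every edge ideal. The coordinates of that class are the
  quotients of the \<open>r k\<close>.\<close>

lemma basis_coefficients_multiples:
  assumes G: "pair_wf_digraph G"
    and basis: "module_basis (rep_ring L) (K_module L G a) I b"
    and e: "e \<in> L"
    and indep: "\<And>p q n k. (p, q) \<in> parcs G \<Longrightarrow>
      of_int n *\<^sub>R e = of_int k *\<^sub>R a (p, q) \<Longrightarrow> n = (0::int)"
    and r: "r \<in> I \<rightarrow> R"
    and mem: "\<And>v. v \<in> pverts G \<Longrightarrow> (\<Sum>k\<in>I. r k * b k v) \<in> euler_multiples e"
    and i: "i \<in> I"
  shows "r i \<in> euler_multiples e"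
proof -
  note b = module_basis_K_moduleD[OF G basis]
  have ex: "\<exists>g. g \<in> R \<and> (\<Sum>k\<in>I. r k * b k v) = (1 - echar e) * g" if "v \<in> pverts G" for v
    using mem[OF that] unfolding euler_multiples_def by (elim imageE) (rule exI conjI | assumption)+
  \<comment> \<open>The quotients are chosen at each vertex separately; the edge conditions between
    them are proved next.\<close>
  define h where "h v = (SOME g. g \<in> R \<and> (\<Sum>k\<in>I. r k * b k v) = (1 - echar e) * g)" for v
  have h: "h v \<in> R" "(\<Sum>k\<in>I. r k * b k v) = (1 - echar e) * h v" if "v \<in> pverts G" for v
    using someI_ex[OF ex[OF that]] unfolding h_def[symmetric] by simp_all
  have "restrict h (pverts G) \<in> carrier (K_ring L G a)"
  proof (rule K_ring_restrictI[OF G])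
    fix p q assume pq: "(p, q) \<in> parcs G"
    have p: "p \<in> pverts G" and q: "q \<in> pverts G"
      using pair_wf_digraph.in_arcsD1[OF G pq] pair_wf_digraph.in_arcsD2[OF G pq] .
    \<comment> \<open>Each \<open>b k\<close> changes along the edge by a multiple of
      \<open>1 - echar (a (p, q))\<close>. Independence of \<open>e\<close> from that weight then
      allows \<open>1 - echar e\<close> to be cancelled.\<close>
    have "(1 - echar e) * (h p - h q) = (\<Sum>k\<in>I. r k * (b k p - b k q))"
      unfolding right_diff_distrib sum_subtractf h(2)[OF p] h(2)[OF q] ..
    also have "\<dots> \<in> euler_multiples (a (p, q))"
      using r by (intro sum_multiples mult_multiples K_ring_edge[OF b(2) pq]) auto
    finally have "(1 - echar e) * (h p - h q) \<in> euler_multiples (a (p, q))" .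
    from cancel_mod_multiples[OF e diff_R[OF h(1)[OF p] h(1)[OF q]] indep[OF pq] this]
    show "h p - h q \<in> euler_multiples (a (p, q))" .
  qed (rule h(1))
  from b(3)[OF this] obtain s
    where s: "s \<in> I \<rightarrow> R" "\<And>v. v \<in> pverts G \<Longrightarrow> h v = (\<Sum>k\<in>I. s k * b k v)"
    by auto
  \<comment> \<open>The families \<open>r\<close> and \<open>(1 - echar e) * s\<close> are
    coordinates of the same combination, so independence of the basis identifies them.\<close>
  have "r i - (1 - echar e) * s i = 0"
  proof (rule b(4)[OF _ _ i])
    show "(\<lambda>k. r k - (1 - echar e) * s k) \<in> I \<rightarrow> R"
      using r s(1) e by (auto intro!: diff_R mult_R echar_R)
    show "(\<Sum>k\<in>I. (r k - (1 - echar e) * s k) * b k v) = 0" if "v \<in> pverts G" for v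
    proof -
      have "(\<Sum>k\<in>I. (r k - (1 - echar e) * s k) * b k v)
          = (\<Sum>k\<in>I. r k * b k v) - (1 - echar e) * (\<Sum>k\<in>I. s k * b k v)"
        by (simp only: left_diff_distrib sum_subtractf sum_distrib_left mult.assoc)
      then show ?thesis
        by (simp only: h(2)[OF that] s(2)[OF that, symmetric] diff_self)
    qed
  qed
  then show ?thesis
    using s(1) i unfolding euler_multiples_def by (intro image_eqI[of _ _ "s i"]) auto
qed

end

section \<open>K-classes on fiber bundles\<close>

lemma gkm_graph_wf: "gkm_graph L \<Gamma> \<alpha> \<Longrightarrow> pair_wf_digraph \<Gamma>"
  unfolding gkm_graph_def regular_graph_def pair_bidirected_digraph_def pair_sym_digraph_def
  by blast

context gkm_fiber_bundle
begin

lemma wf_total: "pair_wf_digraph \<Gamma>" and wf_base: "pair_wf_digraph \<Gamma>\<^sub>B"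
  using gkm_graph_wf total base by blast+

text \<open>Surjectivity of d\<pi> at \<open>v\<close> supplies the edge, and
  \<open>dpi_axial\<close> its weight.\<close>

lemma horizontal_lift:
  assumes "(p, q) \<in> parcs \<Gamma>\<^sub>B" and "v \<in> pverts \<Gamma>" and "\<pi> v = p"
  obtains w where "(v, w) \<in> parcs \<Gamma>" and "\<pi> w = q" and "\<alpha> (v, w) = \<alpha>\<^sub>B (p, q)"
proof -
  have "(p, q) \<in> out_arcs (with_proj \<Gamma>\<^sub>B) (\<pi> v)"
    using assms by simp
  then obtain e where "e \<in> horizontal_edges \<Gamma> \<Gamma>\<^sub>B \<pi> \<inter> out_arcs (with_proj \<Gamma>) v"
      "map_prod \<pi> \<pi> e = (p, q)"
    using dpi_bij[OF assms(2)] unfolding bij_betw_def by (metis imageE)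
  then show ?thesis
    using that[of "snd e"] dpi_axial[of e] by (cases e) (auto simp: horizontal_edges_def)
qed

lemma base_edge_neq: "(p, q) \<in> parcs \<Gamma>\<^sub>B \<Longrightarrow> p \<noteq> q"
  using base unfolding gkm_graph_def regular_graph_def pair_bidirected_digraph_def
  by (auto dest: pair_loopfree_digraph.no_loops')

text \<open>The lift of the base edge at \<open>u\<close> and the vertical edge
  \<open>(u, v)\<close> start at the same vertex and end over different base vertices. They are
  therefore distinct, and the axial function makes their weights independent.\<close>

lemma fiber_edge_independent:
  assumes e: "(p, q) \<in> parcs \<Gamma>\<^sub>B" and uv: "(u, v) \<in> parcs (fiber \<Gamma> \<pi> p)"
    and eq: "of_int n *\<^sub>R \<alpha>\<^sub>B (p, q) = of_int k *\<^sub>R \<alpha> (u, v)"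
  shows "n = (0::int)"
proof -
  have uv: "(u, v) \<in> parcs \<Gamma>" "\<pi> u = p" "\<pi> v = p"
    using uv by (auto simp: fiber_def)
  have u: "u \<in> pverts \<Gamma>"
    using pair_wf_digraph.in_arcsD1[OF wf_total uv(1)] .
  obtain w where w: "(u, w) \<in> parcs \<Gamma>" "\<pi> w = q" "\<alpha> (u, w) = \<alpha>\<^sub>B (p, q)"
    using horizontal_lift[OF e u uv(2)] .
  have "(u, w) \<noteq> (u, v)"
    using w(2) uv(3) base_edge_neq[OF e] by auto
  then have "\<alpha> (u, w) \<noteq> \<alpha> (u, v) \<and> independent {\<alpha> (u, w), \<alpha> (u, v)}"
    using total u uv(1) w(1) unfolding gkm_graph_def integral_axial_function_def
    by simp
  then show ?thesis
    using independent_pair_int eq w(3) by metis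
qed

end

section \<open>The total K-ring over the K-ring of the base\<close>

locale gkm_fiber_bundle_lattice = gkm_fiber_bundle L \<Gamma> \<alpha> nabla \<Gamma>\<^sub>B \<alpha>\<^sub>B nabla\<^sub>B \<pi> + weight_group L
  for L :: "'t::real_vector set"
    and \<Gamma> :: "'v pair_pre_digraph" and \<alpha> :: "'v \<times> 'v \<Rightarrow> 't"
    and nabla :: "'v \<times> 'v \<Rightarrow> 'v \<times> 'v \<Rightarrow> 'v \<times> 'v"
    and \<Gamma>\<^sub>B :: "'w pair_pre_digraph" and \<alpha>\<^sub>B :: "'w \<times> 'w \<Rightarrow> 't"
    and nabla\<^sub>B :: "'w \<times> 'w \<Rightarrow> 'w \<times> 'w \<Rightarrow> 'w \<times> 'w"
    and \<pi> :: "'v \<Rightarrow> 'w"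
begin

abbreviation "K \<equiv> K_ring L \<Gamma> \<alpha>"
abbreviation "K\<^sub>B \<equiv> K_ring L \<Gamma>\<^sub>B \<alpha>\<^sub>B"

lemma pi_verts: "v \<in> pverts \<Gamma> \<Longrightarrow> \<pi> v \<in> pverts \<Gamma>\<^sub>B"
  using surj_verts by blast

lemma pverts_fiber: "v \<in> pverts (fiber \<Gamma> \<pi> p) \<longleftrightarrow> v \<in> pverts \<Gamma> \<and> \<pi> v = p"
  by (simp add: fiber_def)

text \<open>Along a vertical edge the pullback is constant; along a horizontal edge its condition is
  that of the image edge, which has the same weight.\<close>

lemma pullback_K:
  assumes \<beta>: "\<beta> \<in> carrier K\<^sub>B"
  shows "pullback \<Gamma> \<pi> \<beta> \<in> carrier K"
  unfolding pullback_def
proof (rule K_ring_restrictI[OF wf_total])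
  show "\<beta> (\<pi> v) \<in> R" if "v \<in> pverts \<Gamma>" for v
    using K_ring_apply_R[OF \<beta> pi_verts[OF that]] .
  fix p q assume "(p, q) \<in> parcs \<Gamma>"
  then have "(p, q) \<in> vertical_edges \<Gamma> \<pi> \<union> horizontal_edges \<Gamma> \<Gamma>\<^sub>B \<pi>"
    by (simp only: morphism)
  then consider "\<pi> p = \<pi> q" | "(p, q) \<in> horizontal_edges \<Gamma> \<Gamma>\<^sub>B \<pi>"
    by (auto simp: vertical_edges_def)
  then show "\<beta> (\<pi> p) - \<beta> (\<pi> q) \<in> euler_multiples (\<alpha> (p, q))"
  proof cases
    case 2
    then have "(\<pi> p, \<pi> q) \<in> parcs \<Gamma>\<^sub>B" "\<alpha>\<^sub>B (\<pi> p, \<pi> q) = \<alpha> (p, q)"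
      using dpi_axial[OF 2] by (auto simp: horizontal_edges_def)
    with K_ring_edge[OF \<beta>, of "\<pi> p" "\<pi> q"] show ?thesis
      by simp
  qed simp
qed

text \<open>Scalars act by multiplication through the ring homomorphism \<open>pullback\<close>, so
  the module axioms reduce to the ring axioms of \<open>K\<close>.\<close>

lemma module_K_base_module: "Module.module K\<^sub>B (K_base_module L \<Gamma> \<alpha> \<pi>)"
proof -
  interpret K: cring K by (rule cring_K_ring[OF wf_total])
  note ops = K_ring_ops[OF wf_total] K_ring_ops[OF wf_base]
  \<comment> \<open>The additional premise on \<open>\<pi> v\<close> lets the restricted operations
    of the base ring be evaluated there.\<close>
  have restr: "restrict F (pverts \<Gamma>) = restrict G (pverts \<Gamma>)"
    if "\<And>v. v \<in> pverts \<Gamma> \<Longrightarrow> \<pi> v \<in> pverts \<Gamma>\<^sub>B \<Longrightarrow> F v = G v" for F G :: "'v \<Rightarrow> 't \<Rightarrow>\<^sub>0 int"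
    using that pi_verts by (intro restrict_ext) blast
  have pullback_add: "pullback \<Gamma> \<pi> (f \<oplus>\<^bsub>K\<^sub>B\<^esub> g) = pullback \<Gamma> \<pi> f \<oplus>\<^bsub>K\<^esub> pullback \<Gamma> \<pi> g"
    and pullback_mult: "pullback \<Gamma> \<pi> (f \<otimes>\<^bsub>K\<^sub>B\<^esub> g) = pullback \<Gamma> \<pi> f \<otimes>\<^bsub>K\<^esub> pullback \<Gamma> \<pi> g" for f g
    unfolding pullback_def ops by (rule restr; simp)+
  have pullback_one: "pullback \<Gamma> \<pi> \<one>\<^bsub>K\<^sub>B\<^esub> = \<one>\<^bsub>K\<^esub>"
    unfolding pullback_def ops by (rule restr) simp
  show ?thesis
    unfolding K_base_module_def
    by (rule moduleI[OF cring_K_ring[OF wf_base]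
          abelian_group_cong[OF K.abelian_group_axioms with_smult_simps(1-3)]])
      (simp_all only: with_smult_simps pullback_add pullback_mult pullback_one pullback_K
        K.m_closed K.l_distr K.r_distr K.m_assoc K.l_one)
qed

lemma finsum_pullback:
  assumes "finite I" and c: "\<And>k. k \<in> I \<Longrightarrow> c k \<in> carrier K"
    and \<beta>: "\<And>k. k \<in> I \<Longrightarrow> \<beta> k \<in> carrier K\<^sub>B"
  shows "(\<Oplus>\<^bsub>K\<^esub>k\<in>I. pullback \<Gamma> \<pi> (\<beta> k) \<otimes>\<^bsub>K\<^esub> c k) = (\<lambda>v\<in>pverts \<Gamma>. \<Sum>k\<in>I. \<beta> k (\<pi> v) * c k v)"
proof -
  interpret K: cring K by (rule cring_K_ring[OF wf_total])
  have "(\<Oplus>\<^bsub>K\<^esub>k\<in>I. pullback \<Gamma> \<pi> (\<beta> k) \<otimes>\<^bsub>K\<^esub> c k)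
      = (\<lambda>v\<in>pverts \<Gamma>. \<Sum>k\<in>I. (pullback \<Gamma> \<pi> (\<beta> k) \<otimes>\<^bsub>K\<^esub> c k) v)"
    using assms by (intro finsum_K_ring[OF wf_total] K.m_closed pullback_K) simp_all
  also have "\<dots> = (\<lambda>v\<in>pverts \<Gamma>. \<Sum>k\<in>I. \<beta> k (\<pi> v) * c k v)"
    by (rule restrict_ext) (simp add: K_ring_ops[OF wf_total] pullback_def)
  finally show ?thesis .
qed

section \<open>Expansion of classes in the fiber bases\<close>

lemma restrict_fiber_K:
  assumes "f \<in> carrier K"
  shows "restrict f (pverts (fiber \<Gamma> \<pi> p)) \<in> carrier (K_ring L (fiber \<Gamma> \<pi> p) \<alpha>)"
proof (rule K_ring_restrictI[OF pair_wf_digraph_fiber[OF wf_total]])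
  show "f v \<in> R" if "v \<in> pverts (fiber \<Gamma> \<pi> p)" for v
    using that by (intro K_ring_apply_R[OF assms]) (simp add: fiber_def)
  show "f u - f v \<in> euler_multiples (\<alpha> (u, v))" if "(u, v) \<in> parcs (fiber \<Gamma> \<pi> p)" for u v
    using that by (intro K_ring_edge[OF assms]) (simp add: fiber_def)
qed

text \<open>For a base edge \<open>(p, q)\<close>, the differences \<open>r k p - r k q\<close> are
  the coordinates of a combination on the fiber over \<open>p\<close>. Lifting the edge at each
  vertex shows its values to be divisible, and \<open>basis_coefficients_multiples\<close> passes
  this to the coordinates.\<close>

lemma fiber_basis_coefficients_K:
  assumes c: "\<And>k. k \<in> I \<Longrightarrow> c k \<in> carrier K"
    and basis: "\<And>p. p \<in> pverts \<Gamma>\<^sub>B \<Longrightarrow>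
      module_basis (rep_ring L) (K_module L (fiber \<Gamma> \<pi> p) \<alpha>) I
        (\<lambda>k. restrict (c k) (pverts (fiber \<Gamma> \<pi> p)))"
    and f: "f \<in> carrier K"
    and r: "\<And>p k. p \<in> pverts \<Gamma>\<^sub>B \<Longrightarrow> k \<in> I \<Longrightarrow> r k p \<in> R"
    and f_eq: "\<And>v. v \<in> pverts \<Gamma> \<Longrightarrow> f v = (\<Sum>k\<in>I. r k (\<pi> v) * c k v)"
    and i: "i \<in> I"
  shows "restrict (r i) (pverts \<Gamma>\<^sub>B) \<in> carrier K\<^sub>B"
proof (rule K_ring_restrictI[OF wf_base])
  show "r i p \<in> R" if "p \<in> pverts \<Gamma>\<^sub>B" for p
    using r[OF that i] .
  fix p q assume e: "(p, q) \<in> parcs \<Gamma>\<^sub>B"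
  have p: "p \<in> pverts \<Gamma>\<^sub>B" and q: "q \<in> pverts \<Gamma>\<^sub>B"
    using pair_wf_digraph.in_arcsD1[OF wf_base e] pair_wf_digraph.in_arcsD2[OF wf_base e] .
  have "\<alpha>\<^sub>B (p, q) \<in> L"
    using base e unfolding gkm_graph_def integral_axial_function_def by blast
  then show "r i p - r i q \<in> euler_multiples (\<alpha>\<^sub>B (p, q))"
  proof (rule basis_coefficients_multiples[OF pair_wf_digraph_fiber[OF wf_total] basis[OF p]
        _ fiber_edge_independent[OF e] _ _ i])
    show "(\<lambda>k. r k p - r k q) \<in> I \<rightarrow> R"
      using r p q by (intro funcsetI diff_R)
    fix v assume v: "v \<in> pverts (fiber \<Gamma> \<pi> p)"
    then have v': "v \<in> pverts \<Gamma>" "\<pi> v = p"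
      by (simp_all add: pverts_fiber)
    obtain w where w: "(v, w) \<in> parcs \<Gamma>" "\<pi> w = q" "\<alpha> (v, w) = \<alpha>\<^sub>B (p, q)"
      using horizontal_lift[OF e v'] .
    have w': "w \<in> pverts \<Gamma>"
      using pair_wf_digraph.in_arcsD2[OF wf_total w(1)] .
    have "(\<Sum>k\<in>I. (r k p - r k q) * restrict (c k) (pverts (fiber \<Gamma> \<pi> p)) v)
        = (\<Sum>k\<in>I. (r k p - r k q) * c k v)"
      using v by simp
    \<comment> \<open>Adding and subtracting the expansion of \<open>f w\<close>, whose coefficients
      are the \<open>r k q\<close>, leaves only differences of classes along the lifted edge
      \<open>(v, w)\<close>.\<close>
    also have "\<dots> = (f v - f w) - (\<Sum>k\<in>I. r k q * (c k v - c k w))"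
      unfolding f_eq[OF v'(1)] f_eq[OF w'] v'(2) w(2)
      by (simp add: left_diff_distrib right_diff_distrib sum_subtractf)
    also have "\<dots> \<in> euler_multiples (\<alpha> (v, w))"
      by (intro diff_multiples sum_multiples mult_multiples r q
          K_ring_edge[OF f w(1)] K_ring_edge[OF c w(1)])
    finally show "(\<Sum>k\<in>I. (r k p - r k q) * restrict (c k) (pverts (fiber \<Gamma> \<pi> p)) v)
        \<in> euler_multiples (\<alpha>\<^sub>B (p, q))"
      unfolding w(3) .
  qed
qed

text \<open>Independence on each fiber gives injectivity. Spanning on each fiber gives coefficients
  at every base vertex, and these form base classes by \<open>fiber_basis_coefficients_K\<close>,
  whence surjectivity.\<close>

lemma fiber_basis_module_isomorphism:
  assumes c: "\<And>k. k \<in> I \<Longrightarrow> c k \<in> carrier K" and fin: "finite I"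
    and basis: "\<And>p. p \<in> pverts \<Gamma>\<^sub>B \<Longrightarrow>
      module_basis (rep_ring L) (K_module L (fiber \<Gamma> \<pi> p) \<alpha>) I
        (\<lambda>k. restrict (c k) (pverts (fiber \<Gamma> \<pi> p)))"
  shows "module_isomorphism K\<^sub>B (free_module K\<^sub>B I) (K_base_module L \<Gamma> \<alpha> \<pi>)
    (\<lambda>\<beta>. \<Oplus>\<^bsub>K\<^esub>k\<in>I. pullback \<Gamma> \<pi> (\<beta> k) \<otimes>\<^bsub>K\<^esub> c k)"
proof -
  interpret K: cring K by (rule cring_K_ring[OF wf_total])
  interpret B: cring K\<^sub>B by (rule cring_K_ring[OF wf_base])
  note fiber_basis = module_basis_K_moduleD[OF pair_wf_digraph_fiber[OF wf_total] basis]
  define h where "h = (\<lambda>\<beta>. \<Oplus>\<^bsub>K\<^esub>k\<in>I. pullback \<Gamma> \<pi> (\<beta> k) \<otimes>\<^bsub>K\<^esub> c k)"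
  have h: "h \<beta> = (\<lambda>v\<in>pverts \<Gamma>. \<Sum>k\<in>I. \<beta> k (\<pi> v) * c k v)" if "\<beta> \<in> I \<rightarrow> carrier K\<^sub>B" for \<beta>
    unfolding h_def using that by (intro finsum_pullback fin c) auto
  have h_apply: "h \<beta> v = (\<Sum>k\<in>I. \<beta> k (\<pi> v) * c k v)"
    if "\<beta> \<in> I \<rightarrow> carrier K\<^sub>B" "v \<in> pverts \<Gamma>" for \<beta> v
    using that by (simp add: h)
  have h_mem: "h \<beta> \<in> carrier K" if "\<beta> \<in> I \<rightarrow> carrier K\<^sub>B" for \<beta>
    unfolding h_def using that by (intro K.finsum_closed funcsetI K.m_closed pullback_K c) auto
  have "inj_on h (I \<rightarrow>\<^sub>E carrier K\<^sub>B)"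
  proof (rule inj_onI)
    fix \<beta> \<gamma> assume \<beta>: "\<beta> \<in> I \<rightarrow>\<^sub>E carrier K\<^sub>B" and \<gamma>: "\<gamma> \<in> I \<rightarrow>\<^sub>E carrier K\<^sub>B" and eq: "h \<beta> = h \<gamma>"
    have \<beta>': "\<beta> \<in> I \<rightarrow> carrier K\<^sub>B" and \<gamma>': "\<gamma> \<in> I \<rightarrow> carrier K\<^sub>B"
      using \<beta> \<gamma> by auto
    show "\<beta> = \<gamma>"
    proof (rule PiE_ext[OF \<beta> \<gamma>])
      fix i assume i: "i \<in> I"
      show "\<beta> i = \<gamma> i"
      proof (rule K_ring_eqI[OF PiE_mem[OF \<beta> i] PiE_mem[OF \<gamma> i]])
        fix p assume p: "p \<in> pverts \<Gamma>\<^sub>B"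
        \<comment> \<open>For fixed \<open>p\<close> the differences are constants along the fiber
          over \<open>p\<close>, so they are the coefficients of a relation among the restricted
          classes.\<close>
        have "\<beta> i p - \<gamma> i p = 0"
        proof (rule fiber_basis(4)[OF p _ _ i])
          show "(\<lambda>k. \<beta> k p - \<gamma> k p) \<in> I \<rightarrow> R"
            using p by (intro funcsetI diff_R K_ring_apply_R[OF PiE_mem[OF \<beta>]]
                K_ring_apply_R[OF PiE_mem[OF \<gamma>]])
          fix v assume v: "v \<in> pverts (fiber \<Gamma> \<pi> p)"
          then have v': "v \<in> pverts \<Gamma>" "\<pi> v = p"
            by (simp_all add: pverts_fiber)
          have "(\<Sum>k\<in>I. (\<beta> k p - \<gamma> k p) * restrict (c k) (pverts (fiber \<Gamma> \<pi> p)) v) = h \<beta> v - h \<gamma> v"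
            unfolding h_apply[OF \<beta>' v'(1)] h_apply[OF \<gamma>' v'(1)] v'(2)
            using v by (simp add: left_diff_distrib sum_subtractf)
          then show "(\<Sum>k\<in>I. (\<beta> k p - \<gamma> k p) * restrict (c k) (pverts (fiber \<Gamma> \<pi> p)) v) = 0"
            using eq by simp
        qed
        then show "\<beta> i p = \<gamma> i p" by simp
      qed
    qed
  qed
  moreover have "h ` (I \<rightarrow>\<^sub>E carrier K\<^sub>B) = carrier K"
  proof
    show "h ` (I \<rightarrow>\<^sub>E carrier K\<^sub>B) \<subseteq> carrier K"
      using h_mem by auto
    show "carrier K \<subseteq> h ` (I \<rightarrow>\<^sub>E carrier K\<^sub>B)"
    proof
      fix f assume f: "f \<in> carrier K"
      have "\<exists>r. r \<in> I \<rightarrow> R \<and> (\<forall>v\<in>pverts (fiber \<Gamma> \<pi> p). f v = (\<Sum>k\<in>I. r k * c k v))"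
        if "p \<in> pverts \<Gamma>\<^sub>B" for p
        using fiber_basis(3)[OF that restrict_fiber_K[OF f]] by auto
      then have "\<forall>p\<in>pverts \<Gamma>\<^sub>B. \<exists>r. r \<in> I \<rightarrow> R \<and>
          (\<forall>v\<in>pverts (fiber \<Gamma> \<pi> p). f v = (\<Sum>k\<in>I. r k * c k v))"
        by blast
      from bchoice[OF this] obtain r where r: "\<And>p. p \<in> pverts \<Gamma>\<^sub>B \<Longrightarrow> r p \<in> I \<rightarrow> R"
        and f_fiber: "\<And>p v. p \<in> pverts \<Gamma>\<^sub>B \<Longrightarrow> v \<in> pverts (fiber \<Gamma> \<pi> p) \<Longrightarrow>
          f v = (\<Sum>k\<in>I. r p k * c k v)"
        by auto
      \<comment> \<open>Every vertex lies in the fiber over its image, so the separate fiber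
        expansions combine into one formula on all of \<Gamma>.\<close>
      have f_eq: "f v = (\<Sum>k\<in>I. r (\<pi> v) k * c k v)" if "v \<in> pverts \<Gamma>" for v
        using f_fiber[OF pi_verts[OF that]] that by (simp add: pverts_fiber)
      define \<beta> where "\<beta> = (\<lambda>k\<in>I. \<lambda>p\<in>pverts \<Gamma>\<^sub>B. r p k)"
      have "(\<lambda>p\<in>pverts \<Gamma>\<^sub>B. r p k) \<in> carrier K\<^sub>B" if "k \<in> I" for k
        by (rule fiber_basis_coefficients_K[OF c basis f _ f_eq that]) (use r in blast)+
      then have \<beta>: "\<beta> \<in> I \<rightarrow>\<^sub>E carrier K\<^sub>B"
        by (auto simp: \<beta>_def)
      then have \<beta>': "\<beta> \<in> I \<rightarrow> carrier K\<^sub>B"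
        by auto
      have "h \<beta> = f"
      proof (rule K_ring_eqI[OF h_mem[OF \<beta>'] f])
        show "h \<beta> v = f v" if "v \<in> pverts \<Gamma>" for v
          unfolding h_apply[OF \<beta>' that] f_eq[OF that]
          using pi_verts[OF that] by (simp add: \<beta>_def)
      qed
      with \<beta> show "f \<in> h ` (I \<rightarrow>\<^sub>E carrier K\<^sub>B)" by blast
    qed
  qed
  moreover have "h (\<lambda>i\<in>I. \<beta> i \<oplus>\<^bsub>K\<^sub>B\<^esub> \<gamma> i) = h \<beta> \<oplus>\<^bsub>K\<^esub> h \<gamma>"
    if "\<beta> \<in> I \<rightarrow>\<^sub>E carrier K\<^sub>B" "\<gamma> \<in> I \<rightarrow>\<^sub>E carrier K\<^sub>B" for \<beta> \<gamma>
  proof -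
    have mem: "\<beta> \<in> I \<rightarrow> carrier K\<^sub>B" "\<gamma> \<in> I \<rightarrow> carrier K\<^sub>B"
      "(\<lambda>i\<in>I. \<beta> i \<oplus>\<^bsub>K\<^sub>B\<^esub> \<gamma> i) \<in> I \<rightarrow> carrier K\<^sub>B"
      using that by auto
    show ?thesis
    proof (rule K_ring_eqI[OF h_mem[OF mem(3)] K.a_closed[OF h_mem[OF mem(1)] h_mem[OF mem(2)]]])
      fix v assume v: "v \<in> pverts \<Gamma>"
      then show "h (\<lambda>i\<in>I. \<beta> i \<oplus>\<^bsub>K\<^sub>B\<^esub> \<gamma> i) v = (h \<beta> \<oplus>\<^bsub>K\<^esub> h \<gamma>) v"
        using pi_verts[OF v] unfolding K_ring_ops(4)[OF wf_total]
        by (simp add: h_apply[OF mem(1) v] h_apply[OF mem(2) v] h_apply[OF mem(3) v],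
            simp add: K_ring_ops(4)[OF wf_base] distrib_right sum.distrib)
    qed
  qed
  \<comment> \<open>At \<open>v\<close> the scalar enters through its value at
    \<open>\<pi> v\<close>, a common factor of all summands.\<close>
  moreover have "h (\<lambda>i\<in>I. a \<otimes>\<^bsub>K\<^sub>B\<^esub> \<beta> i) = pullback \<Gamma> \<pi> a \<otimes>\<^bsub>K\<^esub> h \<beta>"
    if "a \<in> carrier K\<^sub>B" "\<beta> \<in> I \<rightarrow>\<^sub>E carrier K\<^sub>B" for a \<beta>
  proof -
    have mem: "\<beta> \<in> I \<rightarrow> carrier K\<^sub>B" "(\<lambda>i\<in>I. a \<otimes>\<^bsub>K\<^sub>B\<^esub> \<beta> i) \<in> I \<rightarrow> carrier K\<^sub>B"
      using that by auto
    show ?thesis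
    proof (rule K_ring_eqI[OF h_mem[OF mem(2)]
          K.m_closed[OF pullback_K[OF that(1)] h_mem[OF mem(1)]]])
      fix v assume v: "v \<in> pverts \<Gamma>"
      then show "h (\<lambda>i\<in>I. a \<otimes>\<^bsub>K\<^sub>B\<^esub> \<beta> i) v = (pullback \<Gamma> \<pi> a \<otimes>\<^bsub>K\<^esub> h \<beta>) v"
        using pi_verts[OF v] unfolding K_ring_ops(1)[OF wf_total]
        by (simp add: h_apply[OF mem(1) v] h_apply[OF mem(2) v] pullback_def,
            simp add: K_ring_ops(1)[OF wf_base] sum_distrib_left mult.assoc)
    qed
  qed
  moreover note module_K_base_module module_free_module[OF B.is_cring, of I]
  ultimately show ?thesis
    unfolding module_isomorphism_def h_def[symmetric] bij_betw_def
    by (simp add: free_module_def K_base_module_def with_smult_simps)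
qed

end

theorem theorem5p3:
  fixes L :: "'t::real_vector set"
    and \<Gamma> :: "'v pair_pre_digraph" and \<alpha> :: "'v \<times> 'v \<Rightarrow> 't"
    and nabla :: "'v \<times> 'v \<Rightarrow> 'v \<times> 'v \<Rightarrow> 'v \<times> 'v"
    and \<Gamma>\<^sub>B :: "'w pair_pre_digraph" and \<alpha>\<^sub>B :: "'w \<times> 'w \<Rightarrow> 't"
    and nabla\<^sub>B :: "'w \<times> 'w \<Rightarrow> 'w \<times> 'w \<Rightarrow> 'w \<times> 'w"
    and \<pi> :: "'v \<Rightarrow> 'w"
    and m :: nat and c :: "nat \<Rightarrow> 'v \<Rightarrow> ('t \<Rightarrow>\<^sub>0 int)"
  assumes "weight_lattice L"
    and "gkm_fiber_bundle L \<Gamma> \<alpha> nabla \<Gamma>\<^sub>B \<alpha>\<^sub>B nabla\<^sub>B \<pi>"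
    and "\<And>k. k \<in> {1..m} \<Longrightarrow> c k \<in> carrier (K_ring L \<Gamma> \<alpha>)"
    and "\<And>p. p \<in> pverts \<Gamma>\<^sub>B \<Longrightarrow>
      module_basis (rep_ring L) (K_module L (fiber \<Gamma> \<pi> p) \<alpha>) {1..m}
        (\<lambda>k. restrict (c k) (pverts (fiber \<Gamma> \<pi> p)))"
  shows "module_isomorphism (K_ring L \<Gamma>\<^sub>B \<alpha>\<^sub>B)
           (free_module (K_ring L \<Gamma>\<^sub>B \<alpha>\<^sub>B) {1..m}) (K_base_module L \<Gamma> \<alpha> \<pi>)
           (\<lambda>\<beta>. \<Oplus>\<^bsub>K_ring L \<Gamma> \<alpha>\<^esub>k\<in>{1..m}. pullback \<Gamma> \<pi> (\<beta> k) \<otimes>\<^bsub>K_ring L \<Gamma> \<alpha>\<^esub> c k)"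
proof -
  interpret gkm_fiber_bundle_lattice L \<Gamma> \<alpha> nabla \<Gamma>\<^sub>B \<alpha>\<^sub>B nabla\<^sub>B \<pi>
    by (intro gkm_fiber_bundle_lattice.intro assms weight_lattice_imp_weight_group)
  show ?thesis
    by (rule fiber_basis_module_isomorphism[OF assms(3) _ assms(4)]) simp_all
qed

end
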